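(* Let $k,\nu>0$. For all $x_1,x_2,y>0$ with $x_1<x_2$, $$\frac{x_2+y}{x_1+y}\left(\frac{x_1}{x_2}\right)^{\frac{y}{k\nu}+1}<\frac{B_{k,\nu}(x_2,y)}{B_{k,\nu}(x_1,y)}<\frac{x_2+y}{x_1+y}\left(\frac{x_1}{x_2}\right)\left(\frac{x_1+y+k\nu}{x_2+y+k\nu}\right)^{\frac{y}{k\nu}}.$$
   Context: For $k>0$, $\nu>0$, the $(k,\nu)$ Gamma function is defined (here for $x>0$) by $$\Gamma_{k,\nu}(x)=\lim_{n\to\infty}\frac{n!\,(k\nu)^n\left(\frac{nk}{\nu}\right)^{\frac{x}{k\nu}-1}}{(x)_{n,k\nu}},$$ where for $a\in\mathbb{R}$ and $n\in\mathbb{N}$, $(x)_{n,a}=x(x+a)\cdots(x+(n-1)a)$. The $(k,\nu)$ Beta function is defined for $x,y>0$ by $$B_{k,\nu}(x,y)=\frac{\Gamma_{k,\nu}(x)\Gamma_{k,\nu}(y)}{\Gamma_{k,\nu}(x+y)}.$$ *)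

theory Defs
  imports "HOL-Analysis.Analysis"
begin

definition step_pochhammer :: "real \<Rightarrow> nat \<Rightarrow> real \<Rightarrow> real" where
  "step_pochhammer x n a = (\<Prod>i<n. x + real i * a)"

text \<open>The next two functions are meaningful only for positive \<open>k\<close>, \<open>\<nu>\<close> and positive
  arguments; \<open>lim\<close> is unspecified when the sequence does not converge.\<close>

definition kn_Gamma :: "real \<Rightarrow> real \<Rightarrow> real \<Rightarrow> real" where
  "kn_Gamma k \<nu> x =
     lim (\<lambda>n. fact n * (k * \<nu>) ^ n * (real n * k / \<nu>) powr (x / (k * \<nu>) - 1)
               / step_pochhammer x n (k * \<nu>))"

definition kn_Beta :: "real \<Rightarrow> real \<Rightarrow> real \<Rightarrow> real \<Rightarrow> real" where
  "kn_Beta k \<nu> x y = kn_Gamma k \<nu> x * kn_Gamma k \<nu> y / kn_Gamma k \<nu> (x + y)"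

end

theory Submission
  imports Defs
begin

text \<open>
  After rescaling the argument, the two-parameter Gamma function is Euler's one up to a power:
  with \<open>s = x / (k * \<nu>)\<close>, each term of the defining sequence with positive index is
  \<open>(k / \<nu>) powr (s - 1)\<close> times \<open>Gamma_series' s\<close>. In a quotient of two Beta values with the same second argument
  all these powers cancel, leaving \<open>Gamma v * Gamma (u + t) / (Gamma (v + t) * Gamma u)\<close> with
  \<open>u = x1 / (k * \<nu>)\<close>, \<open>v = x2 / (k * \<nu>)\<close> and \<open>t = y / (k * \<nu>)\<close>. The rational factors in the
  claim are exactly what the shift \<open>Gamma (z + 1) = z * Gamma z\<close> produces, so with
  \<open>G w = Gamma (w + 1) / Gamma (w + 1 + t)\<close> the claim reads
  \<open>(u / v) powr t < G v / G u < ((u + t + 1) / (v + t + 1)) powr t\<close>.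
  In other words, \<open>w powr t * G w\<close> increases strictly and
  \<open>(w + 1 + t) powr t * G w\<close> decreases strictly.

  Taking logarithmic derivatives, both facts become bounds on the increment of the Digamma
  function over an interval of length \<open>t\<close>, namely that its average slope on \<open>[w + 1, w + 1 + t]\<close>
  lies strictly between \<open>1 / (w + 1 + t)\<close> and \<open>1 / w\<close>. These hold because
  \<open>Digamma' (z + 1) < 1 / z < Digamma' z\<close> for positive \<open>z\<close>: the recurrence
  \<open>Digamma (z + 1) - Digamma z = 1 / z\<close> makes \<open>1 / z\<close> a mean value of the strictly decreasing
  derivative \<open>Digamma'\<close> over \<open>[z, z + 1]\<close>.
\<close>

section \<open>The slope of the Digamma function\<close>

lemma Digamma_real_diff_mean_value:
  fixes x y :: real
  assumes "0 < x" "x < y"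
  shows "\<exists>z. x < z \<and> z < y \<and> Digamma y - Digamma x = (y - x) * Polygamma 1 z"
proof -
  have "(Digamma has_real_derivative Polygamma 1 z) (at z)" if "x \<le> z" for z
  proof -
    have "z \<notin> \<int>\<^sub>\<le>\<^sub>0"
      using assms that by (auto elim!: nonpos_Ints_cases)
    then show ?thesis
      using has_field_derivative_Polygamma[of z 0 UNIV] by simp
  qed
  then show ?thesis
    by (intro MVT2[OF assms(2)])
qed

text \<open>Both bounds come from writing \<open>1 / z = Digamma (z + 1) - Digamma z\<close> as a value of
  the strictly decreasing function \<open>Polygamma 1\<close> strictly inside \<open>[z, z + 1]\<close>.\<close>

lemma Polygamma_1_real_bounds:
  fixes z :: real
  assumes "z > 0"
  shows "Polygamma 1 (z + 1) < 1 / z" and "1 / z < Polygamma 1 z"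
proof -
  obtain w where w: "z < w" "w < z + 1"
      "Digamma (z + 1) - Digamma z = (z + 1 - z) * Polygamma 1 w"
    using Digamma_real_diff_mean_value[of z "z + 1"] assms by auto
  have "Polygamma 1 w = 1 / z"
    using w(3) Digamma_plus1[of z] assms by simp
  then show "Polygamma 1 (z + 1) < 1 / z" and "1 / z < Polygamma 1 z"
    using Polygamma_real_strict_antimono[of w "z + 1" 1]
      Polygamma_real_strict_antimono[of z w 1] w assms by auto
qed

lemma Digamma_real_increment_bounds:
  fixes w t :: real
  assumes "w > 0" "t > 0"
  shows "t / (w + 1 + t) < Digamma (w + 1 + t) - Digamma (w + 1)"
    and "Digamma (w + 1 + t) - Digamma (w + 1) < t / w"
proof -
  obtain z where z: "w + 1 < z" "z < w + 1 + t"
      "Digamma (w + 1 + t) - Digamma (w + 1) = t * Polygamma 1 z"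
    using Digamma_real_diff_mean_value[of "w + 1" "w + 1 + t"] assms by auto
  have "1 / (w + 1 + t) < 1 / z"
    using z assms by (simp add: field_simps)
  also have "\<dots> < Polygamma 1 z"
    using z assms by (intro Polygamma_1_real_bounds) simp
  finally have "t * (1 / (w + 1 + t)) < t * Polygamma 1 z"
    using assms(2) by (rule mult_strict_left_mono)
  then show "t / (w + 1 + t) < Digamma (w + 1 + t) - Digamma (w + 1)"
    using z(3) by simp
  have "Polygamma 1 z < Polygamma 1 (w + 1)"
    using z assms by (intro Polygamma_real_strict_antimono) auto
  also have "\<dots> < 1 / w"
    using assms by (intro Polygamma_1_real_bounds)
  finally have "t * Polygamma 1 z < t * (1 / w)"
    using assms(2) by (rule mult_strict_left_mono)
  then show "Digamma (w + 1 + t) - Digamma (w + 1) < t / w"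
    using z(3) by simp
qed

section \<open>Monotonicity of Gamma quotients\<close>

text \<open>The two bounds on the increment of Digamma are precisely the signs of the logarithmic
  derivatives of the functions in the next two lemmas.\<close>

lemma powr_times_Gamma_quotient_strict_increasing:
  fixes u v t :: real
  assumes "0 < u" "u < v" "t > 0"
  shows "u powr t * (Gamma (u + 1) / Gamma (u + 1 + t))
           < v powr t * (Gamma (v + 1) / Gamma (v + 1 + t))"
proof -
  define f where "f = (\<lambda>w::real. t * ln w + ln_Gamma (w + 1) - ln_Gamma (w + 1 + t))"
  have exp_f: "exp (f w) = w powr t * (Gamma (w + 1) / Gamma (w + 1 + t))" if "w > 0" for w
    using that assms by (simp add: f_def exp_add exp_diff powr_def Gamma_real_pos_exp)
  have "f u < f v"
  proof (rule DERIV_pos_imp_increasing[OF \<open>u < v\<close>])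
    fix w assume "u \<le> w" "w \<le> v"
    then have w: "w > 0" using assms by simp
    have "(f has_real_derivative t / w + Digamma (w + 1) - Digamma (w + 1 + t)) (at w)"
      unfolding f_def using w assms by (auto intro!: derivative_eq_intros)
    then show "\<exists>d. (f has_real_derivative d) (at w) \<and> d > 0"
      using Digamma_real_increment_bounds(2)[OF w \<open>t > 0\<close>] by fastforce
  qed
  then have "exp (f u) < exp (f v)" by simp
  then show ?thesis using exp_f assms by simp
qed

lemma powr_times_Gamma_quotient_strict_decreasing:
  fixes u v t :: real
  assumes "0 < u" "u < v" "t > 0"
  shows "(v + 1 + t) powr t * (Gamma (v + 1) / Gamma (v + 1 + t))
           < (u + 1 + t) powr t * (Gamma (u + 1) / Gamma (u + 1 + t))"
proof -
  define f where "f = (\<lambda>w::real. t * ln (w + 1 + t) + ln_Gamma (w + 1) - ln_Gamma (w + 1 + t))"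
  have exp_f: "exp (f w) = (w + 1 + t) powr t * (Gamma (w + 1) / Gamma (w + 1 + t))"
    if "w > 0" for w
    using that assms by (simp add: f_def exp_add exp_diff powr_def Gamma_real_pos_exp)
  have "f v < f u"
  proof (rule DERIV_neg_imp_decreasing[OF \<open>u < v\<close>])
    fix w assume "u \<le> w" "w \<le> v"
    then have w: "w > 0" using assms by simp
    have "(f has_real_derivative t / (w + 1 + t) + Digamma (w + 1) - Digamma (w + 1 + t)) (at w)"
      unfolding f_def using w assms by (auto intro!: derivative_eq_intros)
    then show "\<exists>d. (f has_real_derivative d) (at w) \<and> d < 0"
      using Digamma_real_increment_bounds(1)[OF w \<open>t > 0\<close>] by fastforce
  qed
  then have "exp (f v) < exp (f u)" by simp
  then show ?thesis using exp_f assms by simp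
qed

text \<open>The shift \<open>Gamma (z + 1) = z * Gamma z\<close> trades the regular quotient
  \<open>Gamma (w + 1) / Gamma (w + 1 + t)\<close> for \<open>Gamma w / Gamma (w + t)\<close> and a factor
  \<open>w / (w + t)\<close>; this is the source of the rational factors below.\<close>

lemma Gamma_quotient_ratio_bounds:
  fixes u v t :: real
  assumes "0 < u" "u < v" "t > 0"
  defines "R \<equiv> (Gamma v / Gamma (v + t)) / (Gamma u / Gamma (u + t))"
  shows "(v + t) / (u + t) * (u / v) powr (t + 1) < R"
    and "R < (v + t) / (u + t) * (u / v) * ((u + t + 1) / (v + t + 1)) powr t"
proof -
  define G where "G = (\<lambda>w::real. Gamma (w + 1) / Gamma (w + 1 + t))"
  have G_pos: "G w > 0" if "w > 0" for w
    using that assms by (simp add: G_def)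
  have G_shift: "Gamma w / Gamma (w + t) = (w + t) / w * G w" if "w > 0" for w
  proof -
    have "Gamma (w + 1) = w * Gamma w" "Gamma (w + t + 1) = (w + t) * Gamma (w + t)"
      using that assms by (auto intro!: Gamma_plus1 elim!: nonpos_Ints_cases)
    then show ?thesis
      using that assms by (simp add: G_def add_ac)
  qed
  have pos: "v > 0" "G u > 0" "G v > 0"
    using G_pos assms by auto
  have R: "R = (v + t) / (u + t) * (u / v) * (G v / G u)"
    unfolding R_def using pos assms by (simp add: G_shift mult_ac)
  have factor_pos: "(v + t) / (u + t) * (u / v) > 0"
    using pos assms by simp
  have "u powr t * G u < v powr t * G v"
    unfolding G_def by (rule powr_times_Gamma_quotient_strict_increasing[OF assms(1-3)])
  then have "(u / v) powr t < G v / G u"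
    using pos assms(1) by (simp add: powr_divide field_simps)
  then have "(v + t) / (u + t) * (u / v) * (u / v) powr t < R"
    unfolding R using factor_pos by (rule mult_strict_left_mono)
  then show "(v + t) / (u + t) * (u / v) powr (t + 1) < R"
    using pos assms(1) by (simp add: powr_add mult_ac)
  have "(v + 1 + t) powr t * G v < (u + 1 + t) powr t * G u"
    unfolding G_def by (rule powr_times_Gamma_quotient_strict_decreasing[OF assms(1-3)])
  then have "G v / G u < ((u + t + 1) / (v + t + 1)) powr t"
    using pos assms(1,3) by (simp add: powr_divide field_simps)
  then show "R < (v + t) / (u + t) * (u / v) * ((u + t + 1) / (v + t + 1)) powr t"
    unfolding R using factor_pos by (rule mult_strict_left_mono)
qed

section \<open>Reduction to the classical Gamma function\<close>

lemma step_pochhammer_eq_pochhammer: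
  assumes "a \<noteq> 0"
  shows "step_pochhammer x n a = a ^ n * pochhammer (x / a) n"
proof -
  have "step_pochhammer x n a = (\<Prod>i<n. a * (x / a + real i))"
    unfolding step_pochhammer_def using assms by (intro prod.cong) (auto simp: field_simps)
  then show ?thesis
    by (simp add: prod.distrib pochhammer_prod atLeast0LessThan)
qed

lemma kn_Gamma_eq_Gamma:
  assumes "k > 0" "\<nu> > 0" "x > 0"
  shows "kn_Gamma k \<nu> x = (k / \<nu>) powr (x / (k * \<nu>) - 1) * Gamma (x / (k * \<nu>))"
proof -
  define s where "s = x / (k * \<nu>)"
  have s: "s > 0" using assms by (simp add: s_def)
  define f where "f = (\<lambda>n. fact n * (k * \<nu>) ^ n * (real n * k / \<nu>) powr (s - 1)
                              / step_pochhammer x n (k * \<nu>))"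
  have "(\<lambda>n. (k / \<nu>) powr (s - 1) * Gamma_series' s n) \<longlonglongrightarrow> (k / \<nu>) powr (s - 1) * Gamma s"
    by (intro tendsto_intros Gamma_series'_LIMSEQ)
  moreover have "\<forall>\<^sub>F n in sequentially. (k / \<nu>) powr (s - 1) * Gamma_series' s n = f n"
    using eventually_gt_at_top[of 0]
  proof eventually_elim
    case (elim n)
    have "(real n * k / \<nu>) powr (s - 1) = (real n * (k / \<nu>)) powr (s - 1)"
      by simp
    also have "\<dots> = real n powr (s - 1) * (k / \<nu>) powr (s - 1)"
      using assms by (subst powr_mult) auto
    finally have powr_split:
      "(real n * k / \<nu>) powr (s - 1) = real n powr s / real n * (k / \<nu>) powr (s - 1)"
      using elim by (simp add: powr_diff)
    have fact_split: "(fact n :: real) = real n * fact (n - 1)"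
      using elim by (simp add: fact_reduce)
    have "pochhammer s n > 0" using s by (rule pochhammer_pos)
    moreover have "step_pochhammer x n (k * \<nu>) = (k * \<nu>) ^ n * pochhammer s n"
      using step_pochhammer_eq_pochhammer[of "k * \<nu>"] assms by (simp add: s_def)
    moreover have "(k * \<nu>) ^ n \<noteq> 0" using assms by simp
    moreover have "exp (s * ln (real n)) = real n powr s"
      using elim by (simp add: powr_def)
    ultimately show ?case
      unfolding f_def Gamma_series'_def powr_split fact_split using elim by simp
  qed
  ultimately have "f \<longlonglongrightarrow> (k / \<nu>) powr (s - 1) * Gamma s"
    by (rule Lim_transform_eventually)
  then show ?thesis
    unfolding kn_Gamma_def f_def s_def by (rule limI)
qed

text \<open>The exponents of \<open>k / \<nu>\<close> contribute \<open>(s - 1) + (t - 1) - (s + t - 1) = -1\<close>, where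
  \<open>s\<close> and \<open>t\<close> are the rescaled arguments, so the remaining constant does not depend on them.\<close>

lemma kn_Beta_eq_Gamma:
  assumes "k > 0" "\<nu> > 0" "x > 0" "y > 0"
  shows "kn_Beta k \<nu> x y = \<nu> / k * (Gamma (x / (k * \<nu>)) * Gamma (y / (k * \<nu>))
           / Gamma (x / (k * \<nu>) + y / (k * \<nu>)))"
proof -
  define c s t where "c = k / \<nu>" and "s = x / (k * \<nu>)" and "t = y / (k * \<nu>)"
  have c: "c > 0" using assms by (simp add: c_def)
  have st: "(x + y) / (k * \<nu>) = s + t"
    by (simp add: s_def t_def add_divide_distrib)
  have "kn_Beta k \<nu> x y
      = c powr (s - 1) * c powr (t - 1) / c powr (s + t - 1) * (Gamma s * Gamma t / Gamma (s + t))"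
    unfolding kn_Beta_def using assms by (simp add: kn_Gamma_eq_Gamma st s_def t_def c_def)
  also have "c powr (s - 1) * c powr (t - 1) / c powr (s + t - 1) = 1 / c"
    using c by (simp add: powr_diff powr_add)
  finally show ?thesis by (simp add: c_def s_def t_def)
qed

theorem theorem4p2:
  fixes k \<nu> x1 x2 y :: real
  assumes "k > 0" and "\<nu> > 0"
    and "x1 > 0" and "x2 > 0" and "y > 0" and "x1 < x2"
  shows "(x2 + y) / (x1 + y) * (x1 / x2) powr (y / (k * \<nu>) + 1)
           < kn_Beta k \<nu> x2 y / kn_Beta k \<nu> x1 y
       \<and> kn_Beta k \<nu> x2 y / kn_Beta k \<nu> x1 y
           < (x2 + y) / (x1 + y) * (x1 / x2)
               * ((x1 + y + k * \<nu>) / (x2 + y + k * \<nu>)) powr (y / (k * \<nu>))"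
proof -
  define a u v t where "a = k * \<nu>" and "u = x1 / a" and "v = x2 / a" and "t = y / a"
  have a: "a > 0" using assms by (simp add: a_def)
  have uvt: "0 < u" "u < v" "0 < t"
    using a assms by (simp_all add: u_def v_def t_def divide_strict_right_mono)
  have scale: "x1 = a * u" "x2 = a * v" "y = a * t"
    using a by (simp_all add: u_def v_def t_def)
  have "Gamma t > 0"
    using uvt by simp
  then have beta: "kn_Beta k \<nu> x2 y / kn_Beta k \<nu> x1 y
      = (Gamma v / Gamma (v + t)) / (Gamma u / Gamma (u + t))"
    using assms by (simp add: kn_Beta_eq_Gamma a_def[symmetric] u_def[symmetric]
        v_def[symmetric] t_def[symmetric])
  have sums: "x1 + y = a * (u + t)" "x2 + y = a * (v + t)"
      "x1 + y + a = a * (u + t + 1)" "x2 + y + a = a * (v + t + 1)"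
    unfolding scale by (simp_all add: algebra_simps)
  have cancel: "(a * p) / (a * q) = p / q" for p q
    using a by simp
  have "(x2 + y) / (x1 + y) = (v + t) / (u + t)" "x1 / x2 = u / v"
      "(x1 + y + a) / (x2 + y + a) = (u + t + 1) / (v + t + 1)"
    \<comment> \<open>The longer sums go first, since \<open>x1 + y\<close> is a subterm of \<open>x1 + y + a\<close>.\<close>
    unfolding sums(3,4) unfolding sums(1,2) unfolding scale by (rule cancel)+
  then show ?thesis
    using Gamma_quotient_ratio_bounds[OF uvt] unfolding beta a_def[symmetric] t_def[symmetric]
    by simp
qed

end
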